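(* Let $f$ be a divergence with convex conjugate $g$, and for $X\in\mathcal{L}_{\bar g}$ let $W_g(X)=\sup_{t>0}\left\{-t\left(1+\mathbb{E}\left[g\left(\frac{-X}{t}\right)\right]\right)\right\}$. Then the following properties hold for all $X,Y\in\mathcal{L}_{\bar g}$: (W1) Positive homogeneity: $W_g(\lambda X)=\lambda W_g(X)$ for any $\lambda\ge 0$. (W2) Superadditivity: $W_g(X+Y)\ge W_g(X)+W_g(Y)$. (W3) Monotonicity: if $X\le Y$, then $W_g(X)\le W_g(Y)$. (W4) Aversity: $\mathbb{E}[X]\ge W_g(X)$. (W5) Point-separating: if $X\le 0$, then $W_g(X)=0$ if and only if $X=0$. Furthermore, for every $X\in\mathcal{L}_{\bar g}$, $$\sup_{t>0}\left\{-t\left(1+\mathbb{E}\left[g\left(\frac{-X}{t}\right)\right]\right)\right\}=\inf\left\{\mathbb{E}[XZ]\;\middle|\;Z\in\mathcal{L}_{\bar f},\ Z\ge 0,\ \mathbb{E}[f(Z)]\le 1\right\}.$$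
   Context: All random variables are real-valued on a complete probability space $(\Omega,\mathcal{F},\mathbb{P})$; $\mathbb{E}$ denotes expectation under $\mathbb{P}$; (in)equalities between random variables are meant almost surely. A divergence is a proper, lower-semicontinuous, convex function $f:[0,+\infty)\to[0,+\infty)\cup\{+\infty\}$ such that $f(1)=0$, $f(x)<+\infty$ for every $x\ge 0$ (in particular $f(0)<+\infty$), and $f$ is twice continuously differentiable at every $x>0$. It is extended to $\mathbb{R}$ by $f(x)=+\infty$ for $x<0$. Its convex conjugate is $g:\mathbb{R}\to\mathbb{R}\cup\{+\infty\}$, $g(y)=\sup_{x\in\mathbb{R}}\{xy-f(x)\}$. Define $\bar g(y)=0$ for $y<0$ and $\bar g(y)=g(y)$ for $y\ge 0$; and $\bar f(x)=0$ for $x<1$ and $\bar f(x)=f(x)$ for $x\ge 1$. For a non-negative, increasing (non-decreasing), convex function $\Phi:[0,+\infty)\to[0,+\infty)\cup\{+\infty\}$ with $\Phi(0)=0$, the Orlicz space is $\mathcal{L}_\Phi=\{X\mid \mathbb{E}[\Phi(|X|/\lambda)]<+\infty\text{ for some }\lambda>0\}$; $\mathcal{L}_{\bar g}$ and $\mathcal{L}_{\bar f}$ are the spaces for $\Phi=\bar g$ and $\Phi=\bar f$. *)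

theory Defs
  imports "HOL-Probability.Probability"
begin

(* A divergence takes only finite values on [0, oo), so it is a real function there (in particular
   it is proper); its values at negative arguments are irrelevant, see extend below. *)
definition divergence :: "(real \<Rightarrow> real) \<Rightarrow> bool" where
  "divergence f \<longleftrightarrow>
     (\<forall>x\<ge>0. f x \<ge> 0) \<and>
     f 1 = 0 \<and>
     convex_on {0..} f \<and>
     (\<forall>x\<ge>0. ereal (f x) \<le> Liminf (at x within {0..}) (\<lambda>y. ereal (f y))) \<and>
     (\<exists>f' f''. (\<forall>x>0. (f has_real_derivative f' x) (at x)) \<and>
               (\<forall>x>0. (f' has_real_derivative f'' x) (at x)) \<and>
               continuous_on {0<..} f'')"

definition extend :: "(real \<Rightarrow> real) \<Rightarrow> real \<Rightarrow> ereal" where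
  "extend f x = (if x < 0 then \<infinity> else ereal (f x))"

definition conjugate :: "(real \<Rightarrow> real) \<Rightarrow> real \<Rightarrow> ereal" where
  "conjugate f y = (SUP x. ereal (x * y) - extend f x)"

definition g_bar :: "(real \<Rightarrow> real) \<Rightarrow> real \<Rightarrow> ereal" where
  "g_bar f y = (if y < 0 then 0 else conjugate f y)"

definition f_bar :: "(real \<Rightarrow> real) \<Rightarrow> real \<Rightarrow> ereal" where
  "f_bar f x = (if x < 1 then 0 else extend f x)"

(* Expectation of an extended-real random variable, E[Y+] - E[Y-], since e2ennreal maps negative
   values to 0. The case oo - oo, where the expectation does not exist, gets the value oo of
   extended-real subtraction. *)
definition expect :: "'a measure \<Rightarrow> ('a \<Rightarrow> ereal) \<Rightarrow> ereal" where
  "expect M Y = enn2ereal (\<integral>\<^sup>+\<omega>. e2ennreal (Y \<omega>) \<partial>M) - enn2ereal (\<integral>\<^sup>+\<omega>. e2ennreal (- Y \<omega>) \<partial>M)"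

lemma expect_eq_integral:
  assumes "integrable M X"
  shows "expect M (\<lambda>\<omega>. ereal (X \<omega>)) = ereal (\<integral>\<omega>. X \<omega> \<partial>M)"
proof -
  have fin: "(\<integral>\<^sup>+\<omega>. ennreal (X \<omega>) \<partial>M) \<noteq> \<infinity>" "(\<integral>\<^sup>+\<omega>. ennreal (- X \<omega>) \<partial>M) \<noteq> \<infinity>"
    using assms by (auto simp: real_integrable_def)
  have *: "enn2ereal a = ereal (enn2real a)" if "a \<noteq> \<infinity>" for a
    using that by (cases a) auto
  show ?thesis
    unfolding expect_def using fin by (simp add: real_lebesgue_integral_def[OF assms] *)
qed

lemma expect_nonneg:
  assumes "\<And>\<omega>. Y \<omega> \<ge> 0"
  shows "expect M Y = enn2ereal (\<integral>\<^sup>+\<omega>. e2ennreal (Y \<omega>) \<partial>M)"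
proof -
  have "e2ennreal (- Y \<omega>) = 0" for \<omega>
    using assms[of \<omega>] by (intro e2ennreal_neg) simp
  then show ?thesis by (simp add: expect_def zero_ennreal.rep_eq)
qed

definition Orlicz :: "'a measure \<Rightarrow> (real \<Rightarrow> ereal) \<Rightarrow> ('a \<Rightarrow> real) set" where
  "Orlicz M \<Phi> = {X \<in> borel_measurable M. \<exists>c>0. expect M (\<lambda>\<omega>. \<Phi> (\<bar>X \<omega>\<bar> / c)) < \<infinity>}"

definition W :: "'a measure \<Rightarrow> (real \<Rightarrow> ereal) \<Rightarrow> ('a \<Rightarrow> real) \<Rightarrow> ereal" where
  "W M g X = (SUP t\<in>{0<..}. - ereal t * (1 + expect M (\<lambda>\<omega>. g (- X \<omega> / t))))"

end

(* The dual formula is the heart of the matter: all the properties but homogeneity are read off it.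
   One inequality is Young's x y <= g y + f x. For the other, the infimum restricted to bounded Z is
   a convex program with the single constraint E f(Z) <= 1 and Slater point Z = 1, so it has a
   Lagrange multiplier t >= 0, which bounds E[-X Z] - t E f(Z) uniformly in Z. The supremum of the
   latter over bounded Z is t E g(-X/t): g is a supremum over a countable set of x, so E g(-X/t) is
   the monotone limit of the values at simple Z selecting the best of the first n points. *)

theory Submission
  imports Defs
begin

text \<open>The multiplier must control every \<open>Z\<close> of the program, including those that
  violate the constraint, so \<open>E[X Z]\<close> and \<open>E f(Z)\<close> have to be real for all
  of them; boundedness ensures this as soon as \<open>X\<close> is integrable. The restriction loses
  nothing: the optimal value \<open>v\<close> is still the infimum over all feasible
  \<open>Z\<close>, which bounds the feasible bounded ones from below, and bounded \<open>Z\<close>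
  already recover \<open>E g(-X/t)\<close>. The inequality \<open>y \<le> g y\<close>, which comes
  from \<open>f 1 = 0\<close>, makes \<open>X\<close> integrable. It also gives
  \<open>g(-X/t)\<close> the integrable minorant \<open>-X/t\<close>, so that its expectation is
  never \<infinity> - \<infinity>. The Orlicz scale \<open>c\<close> is itself a value of
  \<open>t\<close> at which the supremum has a finite term; together with \<open>Z = 1\<close> this
  makes \<open>v\<close> real, as the multiplier argument requires. Since \<open>f\<close> is
  arbitrary at negative arguments, measurability of \<open>f(Z)\<close> is obtained through
  \<open>extend f\<close>.\<close>

section \<open>Extended-real expectations\<close>

lemma expect_mono:
  assumes "AE \<omega> in M. Y \<omega> \<le> Y' \<omega>"
  shows "expect M Y \<le> expect M Y'"
  unfolding expect_def
proof (intro ereal_minus_mono)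
  show "enn2ereal (\<integral>\<^sup>+ \<omega>. e2ennreal (Y \<omega>) \<partial>M) \<le> enn2ereal (\<integral>\<^sup>+ \<omega>. e2ennreal (Y' \<omega>) \<partial>M)"
    using assms by (auto simp flip: less_eq_ennreal.rep_eq intro!: nn_integral_mono_AE e2ennreal_mono)
  show "enn2ereal (\<integral>\<^sup>+ \<omega>. e2ennreal (- Y' \<omega>) \<partial>M) \<le> enn2ereal (\<integral>\<^sup>+ \<omega>. e2ennreal (- Y \<omega>) \<partial>M)"
    using assms by (auto simp flip: less_eq_ennreal.rep_eq intro!: nn_integral_mono_AE e2ennreal_mono)
qed

lemma expect_cong:
  assumes "AE \<omega> in M. Y \<omega> = Y' \<omega>"
  shows "expect M Y = expect M Y'"
  using assms by (intro antisym expect_mono) auto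

text \<open>The minorant \<open>h\<close> controls the negative part and finiteness of the
  expectation the positive part. This is the passage from \<open>expect\<close> to Bochner
  integrals.\<close>

lemma expect_finite_imp_integrable:
  assumes [measurable]: "Y \<in> borel_measurable M" and fin: "expect M Y < \<infinity>"
    and h: "integrable M h" "AE \<omega> in M. ereal (h \<omega>) \<le> Y \<omega>"
  obtains y where "integrable M y" "AE \<omega> in M. Y \<omega> = ereal (y \<omega>)"
    "expect M Y = ereal (\<integral>\<omega>. y \<omega> \<partial>M)"
proof -
  define y where "y = (\<lambda>\<omega>. real_of_ereal (Y \<omega>))"
  have [measurable]: "y \<in> borel_measurable M" "h \<in> borel_measurable M"
    using h(1) by (auto simp: y_def)
  \<comment> \<open>By the convention for \<infinity> - \<infinity>, an infinite positive part gives
    the value \<infinity> whatever the negative part is, so \<open>fin\<close> excludes it.\<close>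
  have nn: "(\<integral>\<^sup>+\<omega>. e2ennreal (Y \<omega>) \<partial>M) \<noteq> \<infinity>"
    using fin unfolding expect_def by auto
  have "AE \<omega> in M. e2ennreal (Y \<omega>) \<noteq> \<infinity>"
    by (rule nn_integral_PInf_AE) (use nn in auto)
  with h(2) have eq: "AE \<omega> in M. Y \<omega> = ereal (y \<omega>)"
  proof eventually_elim
    case (elim \<omega>)
    then show ?case by (cases "Y \<omega>") (auto simp: y_def)
  qed
  have "integrable M y"
    unfolding real_integrable_def
  proof (intro conjI)
    have "(\<integral>\<^sup>+\<omega>. ennreal (y \<omega>) \<partial>M) = (\<integral>\<^sup>+\<omega>. e2ennreal (Y \<omega>) \<partial>M)"
      using eq by (intro nn_integral_cong_AE) (auto elim!: eventually_mono)
    then show "(\<integral>\<^sup>+\<omega>. ennreal (y \<omega>) \<partial>M) \<noteq> \<infinity>" using nn by simp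
    have "(\<integral>\<^sup>+\<omega>. ennreal (- y \<omega>) \<partial>M) \<le> (\<integral>\<^sup>+\<omega>. ennreal (- h \<omega>) \<partial>M)"
      using eq h(2) by (intro nn_integral_mono_AE, eventually_elim) (auto intro!: ennreal_leI)
    then show "(\<integral>\<^sup>+\<omega>. ennreal (- y \<omega>) \<partial>M) \<noteq> \<infinity>"
      using h(1) by (auto simp: real_integrable_def top_unique)
  qed simp
  moreover have "expect M Y = ereal (\<integral>\<omega>. y \<omega> \<partial>M)"
    using expect_cong[OF eq] expect_eq_integral[OF calculation] by simp
  ultimately show ?thesis using eq that by blast
qed

text \<open>Monotone convergence for functions of arbitrary sign: subtracting \<open>y 0\<close>
  makes the sequence nonnegative, and the uniform bound \<open>C\<close> then forces the supremum to
  be finite almost everywhere, so that it agrees with a real limit \<open>u\<close>.\<close>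

lemma expect_SUP_le:
  fixes y :: "nat \<Rightarrow> 'a \<Rightarrow> real"
  assumes int: "\<And>n. integrable M (y n)" and inc: "\<And>\<omega>. incseq (\<lambda>n. y n \<omega>)"
    and C: "\<And>n. (\<integral>\<omega>. y n \<omega> \<partial>M) \<le> C"
  shows "expect M (\<lambda>\<omega>. SUP n. ereal (y n \<omega>)) \<le> ereal C"
proof -
  have [measurable]: "\<And>n. y n \<in> borel_measurable M" using int by auto
  define d where "d n \<omega> = y n \<omega> - y 0 \<omega>" for n \<omega>
  have d_int: "integrable M (d n)" for n unfolding d_def using int by auto
  have d_nonneg: "0 \<le> d n \<omega>" for n \<omega> using incseqD[OF inc[of \<omega>], of 0 n] by (simp add: d_def)
  have [measurable]: "\<And>n. d n \<in> borel_measurable M" using d_int by auto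
  have "(\<integral>\<^sup>+\<omega>. (SUP n. ennreal (d n \<omega>)) \<partial>M) = (SUP n. \<integral>\<^sup>+\<omega>. ennreal (d n \<omega>) \<partial>M)"
    by (rule nn_integral_monotone_convergence_SUP)
       (use inc in \<open>auto simp: d_def incseq_def le_fun_def intro!: ennreal_leI\<close>)
  also have "\<dots> \<le> ennreal (C - (\<integral>\<omega>. y 0 \<omega> \<partial>M))"
  proof (rule SUP_least)
    fix n
    have "(\<integral>\<omega>. d n \<omega> \<partial>M) \<le> C - (\<integral>\<omega>. y 0 \<omega> \<partial>M)"
      using C[of n] int unfolding d_def by simp
    then show "(\<integral>\<^sup>+\<omega>. ennreal (d n \<omega>) \<partial>M) \<le> ennreal (C - (\<integral>\<omega>. y 0 \<omega> \<partial>M))"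
      using d_int[of n] d_nonneg by (subst nn_integral_eq_integral) (auto intro: ennreal_leI)
  qed
  finally have "(\<integral>\<^sup>+\<omega>. (SUP n. ennreal (d n \<omega>)) \<partial>M) \<noteq> \<infinity>" by (auto simp: top_unique)
  then have "AE \<omega> in M. (SUP n. ennreal (d n \<omega>)) \<noteq> \<infinity>"
    by (intro nn_integral_PInf_AE) auto
  then have conv: "AE \<omega> in M. convergent (\<lambda>n. y n \<omega>)"
  proof eventually_elim
    case (elim \<omega>)
    then obtain B where B: "(SUP n. ennreal (d n \<omega>)) = ennreal B" "0 \<le> B"
      by (cases "SUP n. ennreal (d n \<omega>)") auto
    have "y n \<omega> \<le> B + y 0 \<omega>" for n
    proof -
      have "ennreal (d n \<omega>) \<le> ennreal B" using SUP_upper[of n UNIV "\<lambda>n. ennreal (d n \<omega>)"] B by simp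
      then show ?thesis using B(2) by (simp add: d_def)
    qed
    then show ?case using inc[of \<omega>]
      by (metis incseq_convergent convergent_def)
  qed
  define u where "u \<omega> = lim (\<lambda>n. y n \<omega>)" for \<omega>
  have [measurable]: "u \<in> borel_measurable M" unfolding u_def by measurable
  have lim: "AE \<omega> in M. (\<lambda>n. y n \<omega>) \<longlonglongrightarrow> u \<omega>"
    using conv by eventually_elim (simp add: u_def convergent_LIMSEQ_iff)
  have incI: "incseq (\<lambda>n. \<integral>\<omega>. y n \<omega> \<partial>M)"
    using inc int by (auto simp: incseq_def intro!: integral_mono)
  obtain L where L: "(\<lambda>n. \<integral>\<omega>. y n \<omega> \<partial>M) \<longlonglongrightarrow> L"
    using incseq_convergent[OF incI] C by blast
  have mono: "AE \<omega> in M. mono (\<lambda>n. y n \<omega>)" using inc by simp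
  have u: "integrable M u" "(\<integral>\<omega>. u \<omega> \<partial>M) = L"
    by (rule integrable_monotone_convergence[OF int mono lim L]
          integral_monotone_convergence[OF int mono lim L], measurable)+
  have "AE \<omega> in M. (SUP n. ereal (y n \<omega>)) = ereal (u \<omega>)"
    using lim
  proof eventually_elim
    case (elim \<omega>)
    have "(\<lambda>n. ereal (y n \<omega>)) \<longlonglongrightarrow> (SUP n. ereal (y n \<omega>))"
      using inc[of \<omega>] by (intro LIMSEQ_SUP) (auto simp: incseq_def)
    moreover have "(\<lambda>n. ereal (y n \<omega>)) \<longlonglongrightarrow> ereal (u \<omega>)" using elim by simp
    ultimately show ?case by (rule LIMSEQ_unique)
  qed
  from expect_cong[OF this] have "expect M (\<lambda>\<omega>. SUP n. ereal (y n \<omega>)) = ereal L"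
    using expect_eq_integral[OF u(1)] u(2) by simp
  then show ?thesis using LIMSEQ_le_const2[OF L] C by auto
qed

section \<open>Lagrange multiplier for one convex constraint\<close>

text \<open>In the plane of the points \<open>(b z, a z)\<close>, a line through
  \<open>(1, V)\<close> with slope \<open>t\<close> has to lie above all points. Points with
  \<open>b z > 1\<close> bound the slope from below, points with \<open>b w < 1\<close> from above,
  and convexity makes these bounds compatible. \<open>T\<close> collects the lower bounds, with 0
  added for the sign of \<open>t\<close>; the Slater point supplies an upper bound, so that
  \<open>Sup T\<close> is meaningful.\<close>

lemma lagrange_multiplier:
  fixes a b :: "'z \<Rightarrow> real"
  assumes conv: "\<And>z w l. z \<in> S \<Longrightarrow> w \<in> S \<Longrightarrow> 0 \<le> l \<Longrightarrow> l \<le> 1 \<Longrightarrow>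
      \<exists>v\<in>S. a v \<ge> l * a z + (1 - l) * a w \<and> b v \<le> l * b z + (1 - l) * b w"
    and opt: "\<And>z. z \<in> S \<Longrightarrow> b z \<le> 1 \<Longrightarrow> a z \<le> V"
    and slater: "z0 \<in> S" "b z0 < 1"
  shows "\<exists>t\<ge>0. \<forall>z\<in>S. a z \<le> V + t * (b z - 1)"
proof -
  define T where "T = insert 0 {(a z - V) / (b z - 1) | z. z \<in> S \<and> b z > 1}"
  have up: "s \<le> (V - a w) / (1 - b w)" if s: "s \<in> T" and w: "w \<in> S" "b w < 1" for s w
  proof (cases "s = 0")
    case True
    then show ?thesis using opt[of w] w by simp
  next
    case False
    then obtain z where z: "z \<in> S" "b z > 1" "s = (a z - V) / (b z - 1)" using s by (auto simp: T_def)
    \<comment> \<open>The weight for which \<open>l * b z + (1 - l) * b w = 1\<close>: the combined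
      point \<open>v\<close> just meets the constraint, and \<open>opt\<close> applies to
      it.\<close>
    define l where "l = (1 - b w) / (b z - b w)"
    have l: "0 \<le> l" "l \<le> 1" using z w by (auto simp: l_def field_simps)
    obtain v where v: "v \<in> S" "a v \<ge> l * a z + (1 - l) * a w" "b v \<le> l * b z + (1 - l) * b w"
      using conv[OF z(1) w(1) l] by blast
    have l': "1 - l = (b z - 1) / (b z - b w)" using z w by (simp add: l_def field_simps)
    have "l * b z + (1 - l) * b w = (1 - b w) * b z / (b z - b w) + (b z - 1) * b w / (b z - b w)"
      unfolding l' by (simp add: l_def)
    also have "\<dots> = ((1 - b w) * b z + (b z - 1) * b w) / (b z - b w)"
      by (simp add: add_divide_distrib)
    also have "(1 - b w) * b z + (b z - 1) * b w = b z - b w" by algebra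
    finally have "b v \<le> 1" using v(3) z w by simp
    then have "l * a z + (1 - l) * a w \<le> V" using opt[OF v(1)] v(2) by linarith
    then have "(1 - b w) * a z / (b z - b w) + (b z - 1) * a w / (b z - b w) \<le> V"
      unfolding l' by (simp add: l_def)
    then have "((1 - b w) * a z + (b z - 1) * a w) / (b z - b w) \<le> V"
      by (simp add: add_divide_distrib)
    then have "(1 - b w) * a z + (b z - 1) * a w \<le> V * (b z - b w)"
      using z w by (simp add: pos_divide_le_eq)
    then have "(a z - V) * (1 - b w) \<le> (V - a w) * (b z - 1)" by (simp add: algebra_simps)
    then have "a z - V \<le> (V - a w) * (b z - 1) / (1 - b w)"
      using w by (simp only: pos_le_divide_eq diff_gt_0_iff_gt)
    then have "a z - V \<le> (V - a w) / (1 - b w) * (b z - 1)"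
      by (simp only: times_divide_eq_left)
    then show ?thesis using z by (simp only: pos_divide_le_eq diff_gt_0_iff_gt)
  qed
  have bdd: "bdd_above T" using up slater by (auto simp: bdd_above_def)
  have "T \<noteq> {}" by (simp add: T_def)
  define t where "t = Sup T"
  have "0 \<le> t" unfolding t_def by (rule cSup_upper[OF _ bdd]) (simp add: T_def)
  moreover have "a z \<le> V + t * (b z - 1)" if z: "z \<in> S" for z
  proof (cases "b z" "1 :: real" rule: linorder_cases)
    case less
    then have "t \<le> (V - a z) / (1 - b z)" unfolding t_def using up z \<open>T \<noteq> {}\<close> by (intro cSup_least) auto
    then show ?thesis using less by (simp add: pos_le_divide_eq algebra_simps)
  next
    case equal
    then show ?thesis using opt z by simp
  next
    case greater
    then have "(a z - V) / (b z - 1) \<le> t" unfolding t_def using z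
      by (intro cSup_upper[OF _ bdd]) (auto simp: T_def)
    then show ?thesis using greater by (simp add: pos_divide_le_eq algebra_simps)
  qed
  ultimately show ?thesis by blast
qed

section \<open>Measurable selection among finitely many points\<close>

text \<open>The earliest maximiser of \<open>x * y - f x\<close> among \<open>q 0\<close>, ...,
  \<open>q n\<close>. The strict comparison fixes a choice at ties, and the recursive form yields
  measurability in \<open>y\<close> and monotonicity of the maximum in \<open>n\<close> by
  induction.\<close>

primrec running_argmax :: "(nat \<Rightarrow> real) \<Rightarrow> (real \<Rightarrow> real) \<Rightarrow> nat \<Rightarrow> real \<Rightarrow> real" where
  "running_argmax q f 0 y = q 0"
| "running_argmax q f (Suc n) y =
    (if q (Suc n) * y - f (q (Suc n)) > running_argmax q f n y * y - f (running_argmax q f n y)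
     then q (Suc n) else running_argmax q f n y)"

text \<open>Both claims go through one induction because the test in the recursion contains
  \<open>f\<close> of the previous selection. For arbitrary \<open>f\<close> this composition is
  still measurable: the selection only takes the values \<open>q 0\<close>, ...,
  \<open>q n\<close>.\<close>

lemma running_argmax_measurable:
  "running_argmax q f n \<in> borel_measurable borel"
  "(\<lambda>y. f (running_argmax q f n y)) \<in> borel_measurable borel"
proof (induction n)
  case 0
  have "running_argmax q f 0 = (\<lambda>y. q 0)" by (rule ext) simp
  then show "running_argmax q f 0 \<in> borel_measurable borel" by simp
  show "(\<lambda>y. f (running_argmax q f 0 y)) \<in> borel_measurable borel" by simp
next
  case (Suc n)
  note [measurable] = Suc
  have "running_argmax q f (Suc n) = (\<lambda>y.
      (if q (Suc n) * y - f (q (Suc n)) > running_argmax q f n y * y - f (running_argmax q f n y)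
       then q (Suc n) else running_argmax q f n y))" by (rule ext) simp
  then show "running_argmax q f (Suc n) \<in> borel_measurable borel"
    by (simp only:) measurable
  have "(\<lambda>y. f (running_argmax q f (Suc n) y)) = (\<lambda>y.
      (if q (Suc n) * y - f (q (Suc n)) > running_argmax q f n y * y - f (running_argmax q f n y)
       then f (q (Suc n)) else f (running_argmax q f n y)))" by (rule ext) simp
  then show "(\<lambda>y. f (running_argmax q f (Suc n) y)) \<in> borel_measurable borel"
    by (simp only:) measurable
qed

lemma running_argmax_in: "running_argmax q f n y \<in> q ` {..n}"
  by (induction n) (auto simp: atMost_Suc)

lemma running_argmax_ge:
  "i \<le> n \<Longrightarrow> q i * y - f (q i) \<le> running_argmax q f n y * y - f (running_argmax q f n y)"
  by (induction n) (force simp: le_Suc_eq)+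

lemma incseq_running_max:
  "incseq (\<lambda>n. running_argmax q f n y * y - f (running_argmax q f n y))"
  by (rule incseq_SucI) simp

section \<open>The divergence and its conjugate\<close>

locale divergence_space = prob_space M for M :: "'a measure" +
  fixes f :: "real \<Rightarrow> real"
  assumes div: "divergence f"
begin

abbreviation g :: "real \<Rightarrow> ereal" where "g \<equiv> conjugate f"

lemma f_nonneg: "0 \<le> x \<Longrightarrow> 0 \<le> f x"
  and f_one: "f 1 = 0"
  and f_convex: "convex_on {0..} f"
  using div by (auto simp: divergence_def)

lemma f_continuous: "continuous_on {0<..} f"
proof -
  obtain f' where "\<forall>x>0. (f has_real_derivative f' x) (at x)"
    using div by (auto simp: divergence_def)
  then show ?thesis
    by (auto intro!: continuous_at_imp_continuous_on DERIV_isCont)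
qed

lemma extend_measurable [measurable]: "extend f \<in> borel_measurable borel"
proof -
  have [measurable]: "(\<lambda>x. indicator {0<..} x *\<^sub>R f x) \<in> borel_measurable borel"
    by (rule borel_measurable_continuous_on_indicator[OF _ f_continuous]) simp
  \<comment> \<open>\<open>f_continuous\<close> covers the open half-line, so the point 0 gets its
    own branch.\<close>
  have "extend f = (\<lambda>x. if x < 0 then \<infinity> else if x = 0 then ereal (f 0)
      else ereal (indicator {0<..} x *\<^sub>R f x))"
    by (auto simp: extend_def fun_eq_iff)
  also have "\<dots> \<in> borel_measurable borel" by measurable
  finally show ?thesis .
qed

lemma conjugate_eq_SUP_nonneg: "g y = (SUP x\<in>{0..}. ereal (x * y - f x))"
proof (rule antisym)
  show "g y \<le> (SUP x\<in>{0..}. ereal (x * y - f x))"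
    unfolding conjugate_def
  proof (rule SUP_least)
    fix x :: real
    show "ereal (x * y) - extend f x \<le> (SUP x\<in>{0..}. ereal (x * y - f x))"
      by (cases "x < 0") (auto simp: extend_def intro!: SUP_upper)
  qed
  show "(SUP x\<in>{0..}. ereal (x * y - f x)) \<le> g y"
    unfolding conjugate_def
  proof (rule SUP_least)
    fix x :: real assume "x \<in> {0..}"
    then show "ereal (x * y - f x) \<le> (SUP x. ereal (x * y) - extend f x)"
      by (intro SUP_upper2[of x]) (auto simp: extend_def)
  qed
qed

lemma conjugate_ge: "0 \<le> x \<Longrightarrow> ereal (x * y - f x) \<le> g y"
  unfolding conjugate_eq_SUP_nonneg by (rule SUP_upper) simp

lemma conjugate_ge_self: "ereal y \<le> g y"
  using conjugate_ge[of 1 y] by (simp add: f_one)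

lemma conjugate_mono: "y \<le> y' \<Longrightarrow> g y \<le> g y'"
  unfolding conjugate_eq_SUP_nonneg
  by (intro SUP_subset_mono) (auto simp: mult_left_mono)

lemma conjugate_zero: "g 0 = 0"
proof (rule antisym)
  show "g 0 \<le> 0" unfolding conjugate_eq_SUP_nonneg by (rule SUP_least) (simp add: f_nonneg)
  show "0 \<le> g 0" using conjugate_ge_self[of 0] by (simp add: zero_ereal_def)
qed

text \<open>Continuity of \<open>f\<close> at \<open>x > 0\<close> lets nearby rationals replace
  \<open>x\<close>, and 0 is rational itself. Countability gives measurability of \<open>g\<close>
  and the monotone approximation of \<open>E g(U)\<close>.\<close>

lemma conjugate_eq_SUP_rat: "g y = (SUP x\<in>\<rat> \<inter> {0..}. ereal (x * y - f x))" (is "_ = ?S")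
proof (rule antisym)
  show "g y \<le> ?S"
    unfolding conjugate_eq_SUP_nonneg
  proof (rule SUP_least)
    fix x :: real assume "x \<in> {0..}"
    then consider "x = 0" | "x > 0" by force
    then show "ereal (x * y - f x) \<le> ?S"
    proof cases
      case 1
      then show ?thesis by (intro SUP_upper) auto
    next
      case 2
      show ?thesis
      proof (rule ereal_le_epsilon2)
        fix e :: real assume "0 < e"
        have "isCont f x" using f_continuous 2 by (simp add: continuous_on_eq_continuous_at)
        then have "isCont (\<lambda>z. z * y - f z) x" by (intro continuous_intros)
        then obtain d where d: "d > 0" "\<And>z. \<bar>z - x\<bar> < d \<Longrightarrow> \<bar>(z * y - f z) - (x * y - f x)\<bar> < e"
          using \<open>0 < e\<close> unfolding continuous_at_eps_delta by (auto simp: dist_real_def)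
        \<comment> \<open>Approximation from the right keeps \<open>z\<close> in the
          half-line.\<close>
        obtain z where z: "z \<in> \<rat>" "x < z" "z < x + d" using Rats_dense_in_real[of x "x + d"] d(1) by auto
        have "ereal (x * y - f x) \<le> ereal (z * y - f z) + ereal e" using d(2)[of z] z by simp
        also have "\<dots> \<le> ?S + ereal e"
          using z 2 by (intro add_right_mono SUP_upper) auto
        finally show "ereal (x * y - f x) \<le> ?S + ereal e" .
      qed
    qed
  qed
  show "?S \<le> g y" unfolding conjugate_eq_SUP_nonneg by (intro SUP_subset_mono) auto
qed

lemma conjugate_eq_SUP_seq:
  obtains q :: "nat \<Rightarrow> real" where "range q = \<rat> \<inter> {0..}" "\<And>y. g y = (SUP n. ereal (q n * y - f (q n)))"
proof -
  have "countable (\<rat> \<inter> {0::real..})" using countable_rat by (rule countable_Int1)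
  moreover have "\<rat> \<inter> {0::real..} \<noteq> {}" by auto
  ultimately obtain q :: "nat \<Rightarrow> real" where q: "\<rat> \<inter> {0..} = range q"
    using uncountable_def by metis
  show ?thesis
  proof (rule that)
    show "range q = \<rat> \<inter> {0..}" by (simp add: q)
    show "g y = (SUP n. ereal (q n * y - f (q n)))" for y
      unfolding conjugate_eq_SUP_rat q image_image ..
  qed
qed

lemma conjugate_measurable [measurable]: "g \<in> borel_measurable borel"
proof -
  obtain q :: "nat \<Rightarrow> real" where q: "\<And>y. g y = (SUP n. ereal (q n * y - f (q n)))"
    by (rule conjugate_eq_SUP_seq) (use that in blast)
  have "(\<lambda>y. SUP n. ereal (q n * y - f (q n))) \<in> borel_measurable borel" by measurable
  then show ?thesis by (simp add: q[abs_def])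
qed

section \<open>Bounded densities and the expectation of the conjugate\<close>

text \<open>By convexity \<open>f\<close> is bounded on \<open>[0, B]\<close> by the larger of its
  two endpoint values.\<close>

lemma integrable_f_bounded:
  assumes [measurable]: "Z \<in> borel_measurable M" and Z: "\<And>\<omega>. 0 \<le> Z \<omega>" "\<And>\<omega>. Z \<omega> \<le> B"
  shows "integrable M (\<lambda>\<omega>. f (Z \<omega>))"
proof (rule integrable_const_bound[where B = "max (f 0) (f B)"])
  have "(\<lambda>\<omega>. f (Z \<omega>)) = (\<lambda>\<omega>. real_of_ereal (extend f (Z \<omega>)))"
    by (simp add: extend_def leD[OF Z(1)])
  also have "\<dots> \<in> borel_measurable M" by measurable
  finally show "(\<lambda>\<omega>. f (Z \<omega>)) \<in> borel_measurable M" .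
  have "f z \<le> max (f 0) (f B)" if "0 \<le> z" "z \<le> B" for z
  proof (cases "B = 0")
    case False
    then have B: "B > 0" using that by simp
    have "f ((1 - z / B) *\<^sub>R 0 + (z / B) *\<^sub>R B) \<le> (1 - z / B) * f 0 + (z / B) * f B"
      using that B by (intro convex_onD[OF f_convex]) (auto simp: field_simps)
    also have "\<dots> \<le> (1 - z / B) * max (f 0) (f B) + (z / B) * max (f 0) (f B)"
      using that B by (intro add_mono mult_left_mono) (auto simp: field_simps)
    finally show ?thesis using B by (simp add: algebra_simps)
  qed (use that in auto)
  then show "AE \<omega> in M. norm (f (Z \<omega>)) \<le> max (f 0) (f B)"
    using Z f_nonneg by auto
qed

lemma integrable_mult_bounded:
  fixes U Z :: "'a \<Rightarrow> real"
  assumes U: "integrable M U" and [measurable]: "Z \<in> borel_measurable M"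
    and Z: "\<And>\<omega>. 0 \<le> Z \<omega>" "\<And>\<omega>. Z \<omega> \<le> B"
  shows "integrable M (\<lambda>\<omega>. U \<omega> * Z \<omega>)"
proof (rule Bochner_Integration.integrable_bound)
  show "integrable M (\<lambda>\<omega>. B * \<bar>U \<omega>\<bar>)" using U by auto
  show "(\<lambda>\<omega>. U \<omega> * Z \<omega>) \<in> borel_measurable M" using U by auto
  have "\<bar>U \<omega>\<bar> * \<bar>Z \<omega>\<bar> \<le> B * \<bar>U \<omega>\<bar>" for \<omega>
    using mult_right_mono[OF Z(2)[of \<omega>], of "\<bar>U \<omega>\<bar>"] Z(1)[of \<omega>] by (simp add: mult.commute)
  then show "AE \<omega> in M. norm (U \<omega> * Z \<omega>) \<le> norm (B * \<bar>U \<omega>\<bar>)"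
    using order.trans[OF Z(1) Z(2)] by (auto simp: abs_mult)
qed

text \<open>The nontrivial half of interchanging expectation and supremum: testing against bounded
  \<open>Z\<close> suffices to bound the expectation of the pointwise supremum.\<close>

lemma expect_conjugate_le:
  assumes U: "integrable M U"
    and le: "\<And>Z B. Z \<in> borel_measurable M \<Longrightarrow> (\<And>\<omega>. 0 \<le> Z \<omega>) \<Longrightarrow> (\<And>\<omega>. Z \<omega> \<le> B) \<Longrightarrow>
      (\<integral>\<omega>. U \<omega> * Z \<omega> \<partial>M) - (\<integral>\<omega>. f (Z \<omega>) \<partial>M) \<le> C"
  shows "expect M (\<lambda>\<omega>. g (U \<omega>)) \<le> ereal C"
proof -
  have [measurable]: "U \<in> borel_measurable M" using U by auto
  obtain q :: "nat \<Rightarrow> real" where q: "range q = \<rat> \<inter> {0..}"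
    "\<And>y. g y = (SUP n. ereal (q n * y - f (q n)))"
    by (rule conjugate_eq_SUP_seq) (use that in blast)
  define Z where "Z n \<omega> = running_argmax q f n (U \<omega>)" for n \<omega>
  have Z_in: "Z n \<omega> \<in> q ` {..n}" for n \<omega> by (simp add: Z_def running_argmax_in)
  have Z_nonneg: "0 \<le> Z n \<omega>" for n \<omega> using Z_in[of n \<omega>] q(1) by auto
  \<comment> \<open>This bound may grow with \<open>n\<close>; \<open>le\<close> allows every
    \<open>B\<close> with the same \<open>C\<close>.\<close>
  have Z_le: "Z n \<omega> \<le> Max (q ` {..n})" for n \<omega> using Z_in by (intro Max_ge) auto
  have Z_meas: "Z n \<in> borel_measurable M" for n
    unfolding Z_def[abs_def] by (rule measurable_compose[OF _ running_argmax_measurable(1)]) simp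
  note UZ = integrable_mult_bounded[OF U Z_meas Z_nonneg Z_le]
  note fZ = integrable_f_bounded[OF Z_meas Z_nonneg Z_le]
  define y where "y n \<omega> = U \<omega> * Z n \<omega> - f (Z n \<omega>)" for n \<omega>
  have "g (U \<omega>) = (SUP n. ereal (y n \<omega>))" for \<omega>
  proof (rule antisym)
    show "g (U \<omega>) \<le> (SUP n. ereal (y n \<omega>))"
      unfolding q(2) y_def Z_def
      by (intro SUP_mono) (use running_argmax_ge[of _ _ q "U \<omega>" f] in \<open>auto simp: mult.commute\<close>)
    show "(SUP n. ereal (y n \<omega>)) \<le> g (U \<omega>)"
      using conjugate_ge[OF Z_nonneg] by (intro SUP_least) (simp add: y_def mult.commute)
  qed
  moreover have "expect M (\<lambda>\<omega>. SUP n. ereal (y n \<omega>)) \<le> ereal C"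
  proof (rule expect_SUP_le)
    show "integrable M (y n)" for n unfolding y_def[abs_def] using UZ fZ by auto
    show "incseq (\<lambda>n. y n \<omega>)" for \<omega>
      using incseq_running_max[of q f "U \<omega>"] by (simp add: y_def Z_def mult.commute)
    show "(\<integral>\<omega>. y n \<omega> \<partial>M) \<le> C" for n
      unfolding y_def using le[OF Z_meas Z_nonneg Z_le] UZ fZ by auto
  qed
  ultimately show ?thesis by simp
qed

section \<open>The Orlicz space of the conjugate\<close>

lemma Orlicz_g_barE:
  assumes "X \<in> Orlicz M (g_bar f)"
  obtains c k where "c > 0" "integrable M k" "AE \<omega> in M. g (\<bar>X \<omega>\<bar> / c) = ereal (k \<omega>)"
proof -
  obtain c where [measurable]: "X \<in> borel_measurable M" and c: "c > 0"
    "expect M (\<lambda>\<omega>. g_bar f (\<bar>X \<omega>\<bar> / c)) < \<infinity>"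
    using assms by (auto simp: Orlicz_def)
  have eq: "g_bar f (\<bar>X \<omega>\<bar> / c) = g (\<bar>X \<omega>\<bar> / c)" for \<omega>
    using c leD[OF divide_nonneg_pos[of "\<bar>X \<omega>\<bar>" c]] by (simp add: g_bar_def)
  have "ereal 0 \<le> g (\<bar>X \<omega>\<bar> / c)" for \<omega>
    using conjugate_mono[of 0 "\<bar>X \<omega>\<bar> / c"] c by (simp add: conjugate_zero zero_ereal_def)
  then show ?thesis
    using expect_finite_imp_integrable[of "\<lambda>\<omega>. g (\<bar>X \<omega>\<bar> / c)" M "\<lambda>_. 0"] c that
    unfolding eq by auto
qed

text \<open>Since \<open>y \<le> g y\<close>, the variable \<open>\<bar>X\<bar> / c\<close> is
  dominated by the integrable \<open>k\<close>.\<close>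

lemma Orlicz_g_bar_integrable:
  assumes X: "X \<in> Orlicz M (g_bar f)"
  shows "integrable M X"
proof -
  obtain c k where c: "c > 0" and k: "integrable M k" "AE \<omega> in M. g (\<bar>X \<omega>\<bar> / c) = ereal (k \<omega>)"
    using Orlicz_g_barE[OF X] .
  show ?thesis
  proof (rule Bochner_Integration.integrable_bound)
    show "integrable M (\<lambda>\<omega>. c * k \<omega>)" using k by auto
    show "X \<in> borel_measurable M" using X by (auto simp: Orlicz_def)
    show "AE \<omega> in M. norm (X \<omega>) \<le> norm (c * k \<omega>)"
      using k(2)
    proof eventually_elim
      case (elim \<omega>)
      then have "\<bar>X \<omega>\<bar> / c \<le> k \<omega>" using conjugate_ge_self[of "\<bar>X \<omega>\<bar> / c"] by simp
      then show ?case using c by (simp add: pos_divide_le_eq mult.commute abs_le_iff)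
    qed
  qed
qed

text \<open>With scale \<open>c + d\<close>, the argument \<open>\<bar>X + Y\<bar> / (c + d)\<close>
  is at most the larger of \<open>\<bar>X\<bar> / c\<close> and \<open>\<bar>Y\<bar> / d\<close>, so
  monotonicity of \<open>g\<close> suffices.\<close>

lemma Orlicz_g_bar_add:
  assumes X: "X \<in> Orlicz M (g_bar f)" and Y: "Y \<in> Orlicz M (g_bar f)"
  shows "(\<lambda>\<omega>. X \<omega> + Y \<omega>) \<in> Orlicz M (g_bar f)"
proof -
  obtain c k where c: "c > 0" and k: "integrable M k" "AE \<omega> in M. g (\<bar>X \<omega>\<bar> / c) = ereal (k \<omega>)"
    using Orlicz_g_barE[OF X] .
  obtain d l where d: "d > 0" and l: "integrable M l" "AE \<omega> in M. g (\<bar>Y \<omega>\<bar> / d) = ereal (l \<omega>)"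
    using Orlicz_g_barE[OF Y] .
  have "AE \<omega> in M. g_bar f (\<bar>X \<omega> + Y \<omega>\<bar> / (c + d)) \<le> ereal (\<bar>k \<omega>\<bar> + \<bar>l \<omega>\<bar>)"
    using k(2) l(2)
  proof eventually_elim
    case (elim \<omega>)
    let ?m = "max (\<bar>X \<omega>\<bar> / c) (\<bar>Y \<omega>\<bar> / d)"
    have "\<bar>X \<omega>\<bar> \<le> ?m * c" "\<bar>Y \<omega>\<bar> \<le> ?m * d"
      using c d by (auto simp flip: pos_divide_le_eq)
    then have "\<bar>X \<omega> + Y \<omega>\<bar> \<le> ?m * (c + d)"
      using abs_triangle_ineq[of "X \<omega>" "Y \<omega>"] unfolding distrib_left by linarith
    then have "\<bar>X \<omega> + Y \<omega>\<bar> / (c + d) \<le> ?m" using c d by (simp add: pos_divide_le_eq)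
    then have "g (\<bar>X \<omega> + Y \<omega>\<bar> / (c + d)) \<le> g ?m" by (rule conjugate_mono)
    also have "\<dots> \<le> ereal (\<bar>k \<omega>\<bar> + \<bar>l \<omega>\<bar>)"
      using elim by (auto simp: max_def)
    finally show ?case using c d by (simp add: g_bar_def)
  qed
  from expect_mono[OF this]
  have "expect M (\<lambda>\<omega>. g_bar f (\<bar>X \<omega> + Y \<omega>\<bar> / (c + d))) \<le> ereal (\<integral>\<omega>. \<bar>k \<omega>\<bar> + \<bar>l \<omega>\<bar> \<partial>M)"
    using k(1) l(1) by (subst (asm) expect_eq_integral) auto
  also have "\<dots> < \<infinity>" by simp
  finally show ?thesis
    using X Y c d by (auto simp: Orlicz_def intro!: exI[of _ "c + d"])
qed

section \<open>Feasible densities\<close>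

definition feasible :: "('a \<Rightarrow> real) \<Rightarrow> bool" where
  "feasible Z \<longleftrightarrow> Z \<in> borel_measurable M \<and> (AE \<omega> in M. Z \<omega> \<ge> 0) \<and>
     expect M (\<lambda>\<omega>. extend f (Z \<omega>)) \<le> 1"

text \<open>Orlicz membership holds with scale 1: on nonnegative values \<open>f_bar f\<close> is
  dominated by \<open>extend f\<close>, whose expectation is at most 1.\<close>

lemma feasible_iff:
  "feasible Z \<longleftrightarrow> Z \<in> Orlicz M (f_bar f) \<and> (AE \<omega> in M. Z \<omega> \<ge> 0) \<and>
     expect M (\<lambda>\<omega>. extend f (Z \<omega>)) \<le> 1"
proof
  assume Z: "feasible Z"
  have "AE \<omega> in M. f_bar f (\<bar>Z \<omega>\<bar> / 1) \<le> extend f (Z \<omega>)"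
    using Z by (simp add: feasible_def) (elim conjE eventually_mono, simp add: f_bar_def extend_def f_nonneg)
  from expect_mono[OF this] have "expect M (\<lambda>\<omega>. f_bar f (\<bar>Z \<omega>\<bar> / 1)) \<le> 1"
    using Z unfolding feasible_def by (blast intro: order.trans)
  then have "expect M (\<lambda>\<omega>. f_bar f (\<bar>Z \<omega>\<bar> / 1)) < \<infinity>" by (rule order.strict_trans1) simp
  then show "Z \<in> Orlicz M (f_bar f) \<and> (AE \<omega> in M. Z \<omega> \<ge> 0) \<and> expect M (\<lambda>\<omega>. extend f (Z \<omega>)) \<le> 1"
    using Z zero_less_one unfolding feasible_def Orlicz_def by blast
qed (auto simp: feasible_def Orlicz_def)

text \<open>\<open>Z\<close> is nonnegative only almost everywhere and \<open>f\<close> is arbitrary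
  below 0, so \<open>z\<close> serves as an integrable version of \<open>f(Z)\<close>.\<close>

lemma feasibleE:
  assumes "feasible Z"
  obtains z where "integrable M z" "AE \<omega> in M. 0 \<le> Z \<omega> \<and> f (Z \<omega>) = z \<omega>" "(\<integral>\<omega>. z \<omega> \<partial>M) \<le> 1"
proof -
  have [measurable]: "Z \<in> borel_measurable M" and Z: "AE \<omega> in M. 0 \<le> Z \<omega>"
    "expect M (\<lambda>\<omega>. extend f (Z \<omega>)) \<le> 1" using assms by (auto simp: feasible_def)
  have "expect M (\<lambda>\<omega>. extend f (Z \<omega>)) < \<infinity>" using Z(2) by (rule order.strict_trans1) simp
  moreover have "AE \<omega> in M. ereal 0 \<le> extend f (Z \<omega>)"
    by (auto simp: extend_def f_nonneg)
  ultimately obtain z where z: "integrable M z" "AE \<omega> in M. extend f (Z \<omega>) = ereal (z \<omega>)"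
    "expect M (\<lambda>\<omega>. extend f (Z \<omega>)) = ereal (\<integral>\<omega>. z \<omega> \<partial>M)"
    using expect_finite_imp_integrable[of "\<lambda>\<omega>. extend f (Z \<omega>)" M "\<lambda>_. 0"] by auto
  have "AE \<omega> in M. 0 \<le> Z \<omega> \<and> f (Z \<omega>) = z \<omega>"
    using Z(1) z(2) by eventually_elim (auto simp: extend_def)
  then show ?thesis using that z Z(2) by (simp add: one_ereal_def)
qed

lemma feasible_bounded:
  assumes Z: "Z \<in> borel_measurable M" "\<And>\<omega>. 0 \<le> Z \<omega>" "\<And>\<omega>. Z \<omega> \<le> B" "(\<integral>\<omega>. f (Z \<omega>) \<partial>M) \<le> 1"
  shows "feasible Z"
proof -
  have "extend f (Z \<omega>) = ereal (f (Z \<omega>))" for \<omega> using Z(2)[of \<omega>] by (simp add: extend_def)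
  then have "expect M (\<lambda>\<omega>. extend f (Z \<omega>)) = ereal (\<integral>\<omega>. f (Z \<omega>) \<partial>M)"
    using expect_eq_integral[OF integrable_f_bounded[OF Z(1-3)]] by simp
  then show ?thesis using Z by (simp add: feasible_def)
qed

lemma feasible_one: "feasible (\<lambda>_. 1)"
  by (rule feasible_bounded[where B = 1]) (auto simp: f_one)

lemma Young:
  assumes "0 \<le> x" "g y = ereal k" shows "x * y \<le> k + f x"
  using conjugate_ge[OF assms(1), of y] assms(2) by simp

text \<open>Young's inequality at \<open>\<bar>X\<bar> / c\<close> dominates
  \<open>\<bar>X\<bar> * Z\<close> by \<open>c * (k + z)\<close>. Integrability is what lets the
  expectation of \<open>(X + Y) * Z\<close> split.\<close>

lemma integrable_mult_feasible:
  assumes X: "X \<in> Orlicz M (g_bar f)" and Z: "feasible Z"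
  shows "integrable M (\<lambda>\<omega>. X \<omega> * Z \<omega>)"
proof -
  obtain c k where c: "c > 0" and k: "integrable M k" "AE \<omega> in M. g (\<bar>X \<omega>\<bar> / c) = ereal (k \<omega>)"
    using Orlicz_g_barE[OF X] .
  obtain z where z: "integrable M z" "AE \<omega> in M. 0 \<le> Z \<omega> \<and> f (Z \<omega>) = z \<omega>"
    using feasibleE[OF Z] .
  show ?thesis
  proof (rule Bochner_Integration.integrable_bound)
    show "integrable M (\<lambda>\<omega>. c * (k \<omega> + z \<omega>))" using k z by auto
    show "(\<lambda>\<omega>. X \<omega> * Z \<omega>) \<in> borel_measurable M"
      using X Z by (auto simp: Orlicz_def feasible_def)
    show "AE \<omega> in M. norm (X \<omega> * Z \<omega>) \<le> norm (c * (k \<omega> + z \<omega>))"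
      using k(2) z(2)
    proof eventually_elim
      case (elim \<omega>)
      then have "Z \<omega> * (\<bar>X \<omega>\<bar> / c) \<le> k \<omega> + z \<omega>" using Young[of "Z \<omega>"] by metis
      then have "\<bar>X \<omega>\<bar> * Z \<omega> \<le> c * (k \<omega> + z \<omega>)" using c by (simp add: pos_divide_le_eq mult.commute)
      also have "\<dots> \<le> \<bar>c * (k \<omega> + z \<omega>)\<bar>" by simp
      finally show ?case using elim by (simp add: abs_mult)
    qed
  qed
qed

lemma conjugate_integrableE:
  assumes "integrable M U" "expect M (\<lambda>\<omega>. g (U \<omega>)) < \<infinity>"
  obtains k where "integrable M k" "AE \<omega> in M. g (U \<omega>) = ereal (k \<omega>)"
    "expect M (\<lambda>\<omega>. g (U \<omega>)) = ereal (\<integral>\<omega>. k \<omega> \<partial>M)"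
proof -
  have "U \<in> borel_measurable M" using assms(1) by auto
  from measurable_compose[OF this conjugate_measurable] show ?thesis
    using expect_finite_imp_integrable[of "\<lambda>\<omega>. g (U \<omega>)" M U] assms conjugate_ge_self that by auto
qed

section \<open>Duality\<close>

text \<open>Young's inequality at \<open>-X/t\<close> is multiplied by \<open>t\<close>, and the 1
  next to \<open>E g(-X/t)\<close> absorbs \<open>E f(Z) \<le> 1\<close>. Here \<open>X\<close> is
  merely integrable, so \<open>X * Z\<close> need not be; the comparison is therefore made with
  \<open>expect_mono\<close>.\<close>

lemma weak_duality:
  assumes X: "integrable M X" and t: "t > 0" and Z: "feasible Z"
  shows "- ereal t * (1 + expect M (\<lambda>\<omega>. g (- X \<omega> / t))) \<le> expect M (\<lambda>\<omega>. ereal (X \<omega> * Z \<omega>))"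
proof (cases "expect M (\<lambda>\<omega>. g (- X \<omega> / t)) = \<infinity>")
  case True
  then show ?thesis using t by simp
next
  case False
  then obtain k where k: "integrable M k" "AE \<omega> in M. g (- X \<omega> / t) = ereal (k \<omega>)"
    "expect M (\<lambda>\<omega>. g (- X \<omega> / t)) = ereal (\<integral>\<omega>. k \<omega> \<partial>M)"
    using conjugate_integrableE[of "\<lambda>\<omega>. - X \<omega> / t"] X by auto
  obtain z where z: "integrable M z" "AE \<omega> in M. 0 \<le> Z \<omega> \<and> f (Z \<omega>) = z \<omega>" "(\<integral>\<omega>. z \<omega> \<partial>M) \<le> 1"
    using feasibleE[OF Z] .
  have "AE \<omega> in M. ereal (- t * (k \<omega> + z \<omega>)) \<le> ereal (X \<omega> * Z \<omega>)"
    using k(2) z(2)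
  proof eventually_elim
    case (elim \<omega>)
    then have "Z \<omega> * (- X \<omega> / t) \<le> k \<omega> + z \<omega>" using Young[of "Z \<omega>"] by metis
    then have "t * (Z \<omega> * (- X \<omega> / t)) \<le> t * (k \<omega> + z \<omega>)" using t by (intro mult_left_mono) auto
    then show ?case using t by (simp add: mult.commute)
  qed
  from expect_mono[OF this]
  have "ereal (- t * ((\<integral>\<omega>. k \<omega> \<partial>M) + (\<integral>\<omega>. z \<omega> \<partial>M))) \<le> expect M (\<lambda>\<omega>. ereal (X \<omega> * Z \<omega>))"
    using k(1) z(1) by (subst (asm) expect_eq_integral) auto
  moreover have "- t * (1 + (\<integral>\<omega>. k \<omega> \<partial>M)) \<le> - t * ((\<integral>\<omega>. k \<omega> \<partial>M) + (\<integral>\<omega>. z \<omega> \<partial>M))"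
    using t z(3) by simp
  ultimately show ?thesis
    unfolding k(3) by (cases "expect M (\<lambda>\<omega>. ereal (X \<omega> * Z \<omega>))") (auto simp: one_ereal_def)
qed

text \<open>The term at \<open>t = c\<close>, the Orlicz scale of \<open>X\<close>, is bounded below
  because \<open>g(-X/c) \<le> g(\<bar>X\<bar>/c)\<close>.\<close>

lemma W_gt_minus_infinity:
  assumes X: "X \<in> Orlicz M (g_bar f)"
  shows "W M g X > - \<infinity>"
proof -
  obtain c k where c: "c > 0" and k: "integrable M k" "AE \<omega> in M. g (\<bar>X \<omega>\<bar> / c) = ereal (k \<omega>)"
    using Orlicz_g_barE[OF X] .
  have "AE \<omega> in M. g (- X \<omega> / c) \<le> ereal (k \<omega>)"
    using k(2)
  proof eventually_elim
    case (elim \<omega>)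
    have "g (- X \<omega> / c) \<le> g (\<bar>X \<omega>\<bar> / c)" using c by (intro conjugate_mono divide_right_mono) auto
    with elim show ?case by simp
  qed
  from expect_mono[OF this] have "expect M (\<lambda>\<omega>. g (- X \<omega> / c)) \<le> ereal (\<integral>\<omega>. k \<omega> \<partial>M)"
    using k(1) by (simp add: expect_eq_integral)
  then have "- \<infinity> < - ereal c * (1 + expect M (\<lambda>\<omega>. g (- X \<omega> / c)))"
    using c by (cases "expect M (\<lambda>\<omega>. g (- X \<omega> / c))") (auto simp: one_ereal_def)
  also have "\<dots> \<le> W M g X" unfolding W_def using c by (intro SUP_upper) auto
  finally show ?thesis .
qed

theorem W_duality:
  assumes X: "X \<in> Orlicz M (g_bar f)"
  shows "W M g X = (INF Z\<in>Collect feasible. expect M (\<lambda>\<omega>. ereal (X \<omega> * Z \<omega>)))" (is "_ = ?I")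
proof (rule antisym)
  note X_int = Orlicz_g_bar_integrable[OF X]
  show le: "W M g X \<le> ?I"
    unfolding W_def using weak_duality[OF X_int] by (intro SUP_least INF_greatest) auto
  have "?I \<le> expect M (\<lambda>\<omega>. ereal (X \<omega> * 1))"
    using feasible_one by (intro INF_lower) auto
  then have "?I < \<infinity>" using expect_eq_integral[OF X_int] by auto
  moreover have "?I > - \<infinity>" using W_gt_minus_infinity[OF X] le by (rule order.strict_trans2)
  ultimately obtain v where v: "?I = ereal v" by (cases ?I) auto
  \<comment> \<open>The bounds hold everywhere, not just almost everywhere, so that \<open>f\<close>
    is only evaluated at nonnegative points.\<close>
  define S :: "('a \<Rightarrow> real) set" where "S = {Z \<in> borel_measurable M. \<exists>B. \<forall>\<omega>. 0 \<le> Z \<omega> \<and> Z \<omega> \<le> B}"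
  have fZ: "integrable M (\<lambda>\<omega>. f (Z \<omega>))" if "Z \<in> S" for Z
    using that integrable_f_bounded[of Z] by (auto simp: S_def)
  have XZ: "integrable M (\<lambda>\<omega>. X \<omega> * Z \<omega>)" if "Z \<in> S" for Z
    using that integrable_mult_bounded[OF X_int, of Z] by (auto simp: S_def)
  have "\<exists>t\<ge>0. \<forall>Z\<in>S. (\<integral>\<omega>. - (X \<omega> * Z \<omega>) \<partial>M) \<le> - v + t * ((\<integral>\<omega>. f (Z \<omega>) \<partial>M) - 1)"
  proof (rule lagrange_multiplier)
    fix Z1 Z2 :: "'a \<Rightarrow> real" and l :: real
    assume Z: "Z1 \<in> S" "Z2 \<in> S" and l: "0 \<le> l" "l \<le> 1"
    obtain B1 B2 where B: "\<And>\<omega>. 0 \<le> Z1 \<omega>" "\<And>\<omega>. Z1 \<omega> \<le> B1" "\<And>\<omega>. 0 \<le> Z2 \<omega>" "\<And>\<omega>. Z2 \<omega> \<le> B2"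
      using Z by (auto simp: S_def)
    define Z where "Z \<omega> = l * Z1 \<omega> + (1 - l) * Z2 \<omega>" for \<omega>
    have "0 \<le> Z \<omega>" "Z \<omega> \<le> l * B1 + (1 - l) * B2" for \<omega>
      unfolding Z_def using l B by (auto intro!: add_mono mult_left_mono add_nonneg_nonneg)
    moreover have "Z \<in> borel_measurable M" using Z by (auto simp: S_def Z_def[abs_def])
    ultimately have ZS: "Z \<in> S" by (auto simp: S_def)
    have "f (Z \<omega>) \<le> l * f (Z1 \<omega>) + (1 - l) * f (Z2 \<omega>)" for \<omega>
      \<comment> \<open>The parameter of \<open>convex_onD\<close> is the weight of the second
        point, hence \<open>1 - l\<close>.\<close>
      using convex_onD[OF f_convex, of "1 - l" "Z1 \<omega>" "Z2 \<omega>"] l B by (simp add: Z_def)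
    then have "(\<integral>\<omega>. f (Z \<omega>) \<partial>M) \<le> (\<integral>\<omega>. l * f (Z1 \<omega>) + (1 - l) * f (Z2 \<omega>) \<partial>M)"
      using fZ Z ZS by (intro integral_mono) auto
    also have "\<dots> = l * (\<integral>\<omega>. f (Z1 \<omega>) \<partial>M) + (1 - l) * (\<integral>\<omega>. f (Z2 \<omega>) \<partial>M)"
      using fZ Z by simp
    finally have "(\<integral>\<omega>. f (Z \<omega>) \<partial>M) \<le> l * (\<integral>\<omega>. f (Z1 \<omega>) \<partial>M) + (1 - l) * (\<integral>\<omega>. f (Z2 \<omega>) \<partial>M)" .
    moreover have "(\<integral>\<omega>. X \<omega> * Z \<omega> \<partial>M) = (\<integral>\<omega>. l * (X \<omega> * Z1 \<omega>) + (1 - l) * (X \<omega> * Z2 \<omega>) \<partial>M)"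
      by (intro Bochner_Integration.integral_cong) (auto simp: Z_def algebra_simps)
    moreover have "\<dots> = l * (\<integral>\<omega>. X \<omega> * Z1 \<omega> \<partial>M) + (1 - l) * (\<integral>\<omega>. X \<omega> * Z2 \<omega> \<partial>M)"
      using XZ Z by simp
    ultimately show "\<exists>Z\<in>S. l * (\<integral>\<omega>. - (X \<omega> * Z1 \<omega>) \<partial>M) + (1 - l) * (\<integral>\<omega>. - (X \<omega> * Z2 \<omega>) \<partial>M)
        \<le> (\<integral>\<omega>. - (X \<omega> * Z \<omega>) \<partial>M) \<and>
        (\<integral>\<omega>. f (Z \<omega>) \<partial>M) \<le> l * (\<integral>\<omega>. f (Z1 \<omega>) \<partial>M) + (1 - l) * (\<integral>\<omega>. f (Z2 \<omega>) \<partial>M)"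
      using ZS by (intro bexI[of _ Z]) auto
  next
    fix Z assume Z: "Z \<in> S" "(\<integral>\<omega>. f (Z \<omega>) \<partial>M) \<le> 1"
    then have "feasible Z" using feasible_bounded[of Z] by (auto simp: S_def)
    then have "?I \<le> expect M (\<lambda>\<omega>. ereal (X \<omega> * Z \<omega>))" by (intro INF_lower) auto
    then show "(\<integral>\<omega>. - (X \<omega> * Z \<omega>) \<partial>M) \<le> - v"
      using v expect_eq_integral[OF XZ[OF Z(1)]] by simp
  next
    show "(\<lambda>_. 1) \<in> S" by (auto simp: S_def)
    show "(\<integral>\<omega>. f 1 \<partial>M) < 1" by (simp add: f_one)
  qed
  then obtain t where t: "t \<ge> 0"
    "\<And>Z. Z \<in> S \<Longrightarrow> (\<integral>\<omega>. - (X \<omega> * Z \<omega>) \<partial>M) \<le> - v + t * ((\<integral>\<omega>. f (Z \<omega>) \<partial>M) - 1)" by blast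
  show "?I \<le> W M g X"
  proof (rule ereal_le_epsilon2)
    fix e :: real assume e: "0 < e"
    \<comment> \<open>The multiplier may vanish, whereas the supremum ranges over positive \<open>t\<close> only.\<close>
    define s where "s = t + e"
    have s: "s > 0" "t \<le> s" using e t by (auto simp: s_def)
    \<comment> \<open>Because \<open>E f(Z) \<ge> 0\<close>, the multiplier inequality survives the
      replacement of \<open>t\<close> by \<open>s\<close> in front of \<open>E f(Z)\<close>, with
      the constant \<open>- v - t\<close> unchanged. Division by \<open>s\<close> gives the bound,
      and the term of the supremum at \<open>s\<close> is then at least
      \<open>v + t - s = v - e\<close>.\<close>
    have "expect M (\<lambda>\<omega>. g (- X \<omega> / s)) \<le> ereal ((- v - t) / s)"
    proof (rule expect_conjugate_le)
      show "integrable M (\<lambda>\<omega>. - X \<omega> / s)" using X_int by auto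
      fix Z :: "'a \<Rightarrow> real" and B assume "Z \<in> borel_measurable M" "\<And>\<omega>. 0 \<le> Z \<omega>" "\<And>\<omega>. Z \<omega> \<le> B"
      then have Z: "Z \<in> S" by (auto simp: S_def)
      have "0 \<le> (\<integral>\<omega>. f (Z \<omega>) \<partial>M)" 
        using f_nonneg[OF \<open>\<And>\<omega>. 0 \<le> Z \<omega>\<close>] by simp
      then have "t * (\<integral>\<omega>. f (Z \<omega>) \<partial>M) \<le> s * (\<integral>\<omega>. f (Z \<omega>) \<partial>M)" using s by (intro mult_right_mono)
      then have "- (\<integral>\<omega>. X \<omega> * Z \<omega> \<partial>M) - s * (\<integral>\<omega>. f (Z \<omega>) \<partial>M) \<le> - v - t"
        using t(2)[OF Z] by (simp add: algebra_simps)
      then have "(- (\<integral>\<omega>. X \<omega> * Z \<omega> \<partial>M) - s * (\<integral>\<omega>. f (Z \<omega>) \<partial>M)) / s \<le> (- v - t) / s"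
        using s by (intro divide_right_mono) auto
      then show "(\<integral>\<omega>. - X \<omega> / s * Z \<omega> \<partial>M) - (\<integral>\<omega>. f (Z \<omega>) \<partial>M) \<le> (- v - t) / s"
        using s by (simp add: diff_divide_distrib)
    qed
    then have "ereal (v - e) \<le> - ereal s * (1 + expect M (\<lambda>\<omega>. g (- X \<omega> / s)))"
      using s by (cases "expect M (\<lambda>\<omega>. g (- X \<omega> / s))") (auto simp: one_ereal_def s_def field_simps)
    also have "\<dots> \<le> W M g X" unfolding W_def using s by (intro SUP_upper) auto
    finally have "ereal (v - e) \<le> W M g X" .
    then show "?I \<le> W M g X + ereal e"
      unfolding v by (cases "W M g X") auto
  qed
qed

section \<open>Properties of \<open>W\<close>\<close>

lemma W_le_expect_mult:
  assumes "X \<in> Orlicz M (g_bar f)" "feasible Z"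
  shows "W M g X \<le> expect M (\<lambda>\<omega>. ereal (X \<omega> * Z \<omega>))"
  unfolding W_duality[OF assms(1)] using assms(2) by (intro INF_lower) auto

text \<open>As \<open>g 0 = 0\<close>, the terms are \<open>- t\<close>; their supremum is
  approached as \<open>t\<close> tends to 0 and is not attained.\<close>

lemma W_zero: "W M g (\<lambda>_. 0) = 0"
proof -
  have "expect M (\<lambda>_. ereal 0) = 0" by (subst expect_eq_integral) (auto simp: zero_ereal_def)
  then have "expect M (\<lambda>_. 0) = 0" by (simp add: zero_ereal_def)
  then have "W M g (\<lambda>_. 0) = (SUP t\<in>{0<..}. - ereal t)"
    unfolding W_def by (simp add: conjugate_zero)
  also have "\<dots> = 0"
  proof (rule antisym)
    show "(SUP t\<in>{0<..}. - ereal t) \<le> 0" by (rule SUP_least) simp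
    show "0 \<le> (SUP t\<in>{0<..}. - ereal t)"
    proof (rule ereal_le_epsilon2)
      fix e :: real assume "0 < e"
      then have "- ereal e \<le> (SUP t\<in>{0<..}. - ereal t)" by (intro SUP_upper) auto
      then show "0 \<le> (SUP t\<in>{0<..}. - ereal t) + ereal e"
        by (cases "SUP t\<in>{0<..}. - ereal t") (auto simp: zero_ereal_def)
    qed
  qed
  finally show ?thesis .
qed

lemma W_cong_AE:
  assumes "AE \<omega> in M. X \<omega> = Y \<omega>"
  shows "W M g X = W M g Y"
  unfolding W_def
proof (intro SUP_cong refl arg_cong2[where f = "(*)"] arg_cong2[where f = "(+)"] expect_cong)
  fix t :: real
  show "AE \<omega> in M. g (- X \<omega> / t) = g (- Y \<omega> / t)" using assms by eventually_elim simp
qed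

text \<open>For \<open>c > 0\<close> the substitution of \<open>c * t\<close> for \<open>t\<close>
  permutes the positive reals and pulls out the factor \<open>c\<close>. For \<open>c = 0\<close>
  the right side is 0 even at an infinite \<open>W\<close>, since 0 times \<infinity> is 0 in
  \<open>ereal\<close>.\<close>

lemma W_scale:
  assumes "c \<ge> 0"
  shows "W M g (\<lambda>\<omega>. c * X \<omega>) = ereal c * W M g X"
proof (cases "c = 0")
  case True
  then show ?thesis using W_zero by (simp flip: zero_ereal_def)
next
  case False
  with assms have c: "c > 0" by simp
  have "(*) c ` {0<..} = {0::real<..}"
  proof (intro equalityI subsetI)
    fix t :: real assume "t \<in> {0<..}"
    then show "t \<in> (*) c ` {0<..}" using c by (intro image_eqI[of _ _ "t / c"]) auto
  qed (use c in auto)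
  then have "W M g (\<lambda>\<omega>. c * X \<omega>) =
      (SUP t\<in>(*) c ` {0<..}. - ereal t * (1 + expect M (\<lambda>\<omega>. g (- (c * X \<omega>) / t))))"
    unfolding W_def by simp
  also have "\<dots> = (SUP t\<in>{0<..}. ereal c * (- ereal t * (1 + expect M (\<lambda>\<omega>. g (- X \<omega> / t)))))"
    unfolding image_image
  proof (intro SUP_cong refl)
    fix t :: real
    have "- (c * X \<omega>) / (c * t) = - X \<omega> / t" for \<omega> using c by simp
    moreover have "- ereal (c * t) = ereal c * (- ereal t)" by simp
    ultimately show "- ereal (c * t) * (1 + expect M (\<lambda>\<omega>. g (- (c * X \<omega>) / (c * t)))) =
        ereal c * (- ereal t * (1 + expect M (\<lambda>\<omega>. g (- X \<omega> / t))))"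
      by (simp only: mult.assoc)
  qed
  also have "\<dots> = ereal c * W M g X"
    unfolding W_def using c by (intro Sup_ereal_mult_left'[symmetric]) auto
  finally show ?thesis .
qed

text \<open>For a fixed feasible \<open>Z\<close> the functional \<open>E[X Z]\<close> is additive
  in \<open>X\<close>, and each summand dominates its own infimum.\<close>

lemma W_superadditive:
  assumes X: "X \<in> Orlicz M (g_bar f)" and Y: "Y \<in> Orlicz M (g_bar f)"
  shows "W M g X + W M g Y \<le> W M g (\<lambda>\<omega>. X \<omega> + Y \<omega>)"
  unfolding W_duality[OF Orlicz_g_bar_add[OF X Y]]
proof (rule INF_greatest)
  fix Z assume "Z \<in> Collect feasible"
  then have Z: "feasible Z" by simp
  note int = integrable_mult_feasible[OF X Z] integrable_mult_feasible[OF Y Z]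
  have "W M g X + W M g Y \<le> expect M (\<lambda>\<omega>. ereal (X \<omega> * Z \<omega>)) + expect M (\<lambda>\<omega>. ereal (Y \<omega> * Z \<omega>))"
    using X Y Z by (intro add_mono W_le_expect_mult)
  also have "\<dots> = ereal (\<integral>\<omega>. X \<omega> * Z \<omega> + Y \<omega> * Z \<omega> \<partial>M)"
    using int by (simp add: expect_eq_integral)
  also have "\<dots> = expect M (\<lambda>\<omega>. ereal ((X \<omega> + Y \<omega>) * Z \<omega>))"
    using int by (subst expect_eq_integral[symmetric]) (auto simp: distrib_right)
  finally show "W M g X + W M g Y \<le> expect M (\<lambda>\<omega>. ereal ((X \<omega> + Y \<omega>) * Z \<omega>))" .
qed

lemma W_mono:
  assumes X: "X \<in> Orlicz M (g_bar f)" and Y: "Y \<in> Orlicz M (g_bar f)"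
    and le: "AE \<omega> in M. X \<omega> \<le> Y \<omega>"
  shows "W M g X \<le> W M g Y"
  unfolding W_duality[OF Y]
proof (rule INF_greatest)
  fix Z assume "Z \<in> Collect feasible"
  then have Z: "feasible Z" "AE \<omega> in M. 0 \<le> Z \<omega>" by (auto simp: feasible_def)
  have "AE \<omega> in M. ereal (X \<omega> * Z \<omega>) \<le> ereal (Y \<omega> * Z \<omega>)"
    using le Z(2) by eventually_elim (simp add: mult_right_mono)
  then show "W M g X \<le> expect M (\<lambda>\<omega>. ereal (Y \<omega> * Z \<omega>))"
    by (rule order.trans[OF W_le_expect_mult[OF X Z(1)] expect_mono])
qed

lemma W_le_expect:
  assumes "X \<in> Orlicz M (g_bar f)"
  shows "W M g X \<le> expect M (\<lambda>\<omega>. ereal (X \<omega>))"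
  using W_le_expect_mult[OF assms feasible_one] by simp

text \<open>Aversity turns \<open>W M g X = 0\<close> into \<open>E[X] \<ge> 0\<close>, which for
  nonpositive \<open>X\<close> forces \<open>X = 0\<close> almost everywhere.\<close>

lemma W_eq_zero_iff:
  assumes X: "X \<in> Orlicz M (g_bar f)" and le: "AE \<omega> in M. X \<omega> \<le> 0"
  shows "W M g X = 0 \<longleftrightarrow> (AE \<omega> in M. X \<omega> = 0)"
proof
  assume "W M g X = 0"
  then have "0 \<le> (\<integral>\<omega>. X \<omega> \<partial>M)"
    using W_le_expect[OF X] expect_eq_integral[OF Orlicz_g_bar_integrable[OF X]]
    by (simp add: zero_ereal_def)
  moreover have "0 \<le> (\<integral>\<omega>. - X \<omega> \<partial>M)" using le by (intro integral_nonneg_AE) auto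
  ultimately have "(\<integral>\<omega>. - X \<omega> \<partial>M) = 0" by simp
  then have "AE \<omega> in M. - X \<omega> = 0"
    using le Orlicz_g_bar_integrable[OF X] by (subst (asm) integral_nonneg_eq_0_iff_AE) auto
  then show "AE \<omega> in M. X \<omega> = 0" by simp
next
  assume "AE \<omega> in M. X \<omega> = 0"
  then have "W M g X = W M g (\<lambda>_. 0)" by (rule W_cong_AE)
  then show "W M g X = 0" by (simp only: W_zero)
qed

end

theorem proposition1:
  fixes M :: "'a measure" and f :: "real \<Rightarrow> real" and g :: "real \<Rightarrow> ereal"
  assumes "prob_space M" and "complete_measure M"
    and "divergence f" and "g = conjugate f"
  shows "(\<forall>X \<in> Orlicz M (g_bar f). \<forall>c\<ge>0.
            W M g (\<lambda>\<omega>. c * X \<omega>) = ereal c * W M g X) \<and>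
         (\<forall>X \<in> Orlicz M (g_bar f). \<forall>Y \<in> Orlicz M (g_bar f).
            W M g (\<lambda>\<omega>. X \<omega> + Y \<omega>) \<ge> W M g X + W M g Y) \<and>
         (\<forall>X \<in> Orlicz M (g_bar f). \<forall>Y \<in> Orlicz M (g_bar f).
            (AE \<omega> in M. X \<omega> \<le> Y \<omega>) \<longrightarrow> W M g X \<le> W M g Y) \<and>
         (\<forall>X \<in> Orlicz M (g_bar f). expect M (\<lambda>\<omega>. ereal (X \<omega>)) \<ge> W M g X) \<and>
         (\<forall>X \<in> Orlicz M (g_bar f). (AE \<omega> in M. X \<omega> \<le> 0) \<longrightarrow>
            (W M g X = 0 \<longleftrightarrow> (AE \<omega> in M. X \<omega> = 0))) \<and>
         (\<forall>X \<in> Orlicz M (g_bar f).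
            (SUP t\<in>{0<..}. - ereal t * (1 + expect M (\<lambda>\<omega>. g (- X \<omega> / t)))) =
            Inf {expect M (\<lambda>\<omega>. ereal (X \<omega> * Z \<omega>)) | Z.
                   Z \<in> Orlicz M (f_bar f) \<and> (AE \<omega> in M. Z \<omega> \<ge> 0) \<and>
                   expect M (\<lambda>\<omega>. extend f (Z \<omega>)) \<le> 1})"
proof -
  interpret divergence_space M f
    using assms(1,3) by (intro divergence_space.intro divergence_space_axioms.intro)
  have "Inf {expect M (\<lambda>\<omega>. ereal (X \<omega> * Z \<omega>)) | Z.
      Z \<in> Orlicz M (f_bar f) \<and> (AE \<omega> in M. Z \<omega> \<ge> 0) \<and> expect M (\<lambda>\<omega>. extend f (Z \<omega>)) \<le> 1} =
      (INF Z\<in>Collect feasible. expect M (\<lambda>\<omega>. ereal (X \<omega> * Z \<omega>)))" for X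
    by (rule arg_cong[where f = Inf]) (auto simp: feasible_iff)
  then show ?thesis
    unfolding assms(4) W_def[symmetric]
    using W_scale W_superadditive W_mono W_le_expect W_eq_zero_iff W_duality by simp
qed

end
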